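(* Let $1<p<\infty$, and let $r_1,r_2\ge 0$ and $s_1,s_2>0$ be real numbers. Let $T_0:\ell_p\to\ell_p$ be the bounded linear operator given, for $x=\{x_n\}_{n\ge1}$ (with $x_{-1}=x_0=0$), by $(T_0x)_n=s_1x_{n-2}+r_1x_n+s_1x_{n+2}$ if $n$ is odd and $(T_0x)_n=s_2x_{n-2}+r_2x_n+s_2x_{n+2}$ if $n$ is even. Then the continuous spectrum of $T_0$ over $\ell_p$ is $$\sigma_c(T_0,\ell_p)=[r_1-2s_1,r_1+2s_1]\cup[r_2-2s_2,r_2+2s_2].$$
   Context: $\ell_p$ is the complex Banach space of $p$-summable sequences $x=\{x_n\}_{n\ge 1}$. The continuous spectrum $\sigma_c(A,X)$ of $A\in B(X)$ is the set of $\lambda\in\mathbb{C}$ for which $A-\lambda I$ is injective, the inverse $(A-\lambda I)^{-1}$ (defined on the range) is unbounded, and the range $R(A-\lambda I)$ is dense in $X$ but not equal to $X$. Intervals $[a,b]$ are closed intervals of the real line, viewed as subsets of $\mathbb{C}$. *)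

theory Defs
  imports Complex_Main
begin

text \<open>
  Sequences \<open>{x\<^sub>n}\<close>, \<open>n \<ge> 1\<close>, are functions on \<open>nat\<close> that vanish at the unused index 0. As
  \<open>p\<close> is a real parameter, \<open>\<ell>\<^sub>p\<close> is a carrier set with an explicit norm rather than a type.
\<close>

definition lp :: "real \<Rightarrow> (nat \<Rightarrow> complex) set" where
  "lp p = {x. x 0 = 0 \<and> summable (\<lambda>n. norm (x n) powr p)}"

definition lp_norm :: "real \<Rightarrow> (nat \<Rightarrow> complex) \<Rightarrow> real" where
  "lp_norm p x = (\<Sum>n. norm (x n) powr p) powr (1 / p)"

definition lp_bounded_on ::
  "real \<Rightarrow> (nat \<Rightarrow> complex) set \<Rightarrow> ((nat \<Rightarrow> complex) \<Rightarrow> nat \<Rightarrow> complex) \<Rightarrow> bool" where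
  "lp_bounded_on p D B \<longleftrightarrow> (\<exists>C. \<forall>y\<in>D. lp_norm p (B y) \<le> C * lp_norm p y)"

definition lp_dense :: "real \<Rightarrow> (nat \<Rightarrow> complex) set \<Rightarrow> bool" where
  "lp_dense p R \<longleftrightarrow>
     R \<subseteq> lp p \<and> (\<forall>x\<in>lp p. \<forall>\<epsilon>>0. \<exists>y\<in>R. lp_norm p (\<lambda>n. x n - y n) < \<epsilon>)"

definition lp_bounded_linear :: "real \<Rightarrow> ((nat \<Rightarrow> complex) \<Rightarrow> nat \<Rightarrow> complex) \<Rightarrow> bool" where
  "lp_bounded_linear p A \<longleftrightarrow>
     A ` lp p \<subseteq> lp p \<and>
     (\<forall>x\<in>lp p. \<forall>y\<in>lp p. A (\<lambda>n. x n + y n) = (\<lambda>n. A x n + A y n)) \<and>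
     (\<forall>c. \<forall>x\<in>lp p. A (\<lambda>n. c * x n) = (\<lambda>n. c * A x n)) \<and>
     lp_bounded_on p (lp p) A"

definition shifted_op ::
  "((nat \<Rightarrow> complex) \<Rightarrow> nat \<Rightarrow> complex) \<Rightarrow> complex \<Rightarrow> (nat \<Rightarrow> complex) \<Rightarrow> nat \<Rightarrow> complex" where
  "shifted_op A z = (\<lambda>x n. A x n - z * x n)"

text \<open>Meant for \<open>A\<close> with \<open>lp_bounded_linear p A\<close>.\<close>

definition cont_spectrum ::
  "((nat \<Rightarrow> complex) \<Rightarrow> nat \<Rightarrow> complex) \<Rightarrow> real \<Rightarrow> complex set" where
  "cont_spectrum A p =
     {z. inj_on (shifted_op A z) (lp p) \<and>
         \<not> lp_bounded_on p (shifted_op A z ` lp p) (inv_into (lp p) (shifted_op A z)) \<and>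
         lp_dense p (shifted_op A z ` lp p) \<and>
         shifted_op A z ` lp p \<noteq> lp p}"

text \<open>
  For \<open>n = 1\<close> the truncated \<open>n - 2\<close> is 0, and \<open>x 0 = 0\<close> on \<open>lp p\<close>, so \<open>x (n - 2)\<close> also
  covers the convention \<open>x\<^sub>-\<^sub>1 = x\<^sub>0 = 0\<close>.
\<close>

definition T0 ::
  "real \<Rightarrow> real \<Rightarrow> real \<Rightarrow> real \<Rightarrow> (nat \<Rightarrow> complex) \<Rightarrow> nat \<Rightarrow> complex" where
  "T0 r\<^sub>1 r\<^sub>2 s\<^sub>1 s\<^sub>2 x n =
     (if n = 0 then 0
      else if odd n then of_real s\<^sub>1 * x (n - 2) + of_real r\<^sub>1 * x n + of_real s\<^sub>1 * x (n + 2)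
      else of_real s\<^sub>2 * x (n - 2) + of_real r\<^sub>2 * x n + of_real s\<^sub>2 * x (n + 2))"

lemma T0_bounded_linear:
  assumes p: "1 < p"
  shows "lp_bounded_linear p (T0 r\<^sub>1 r\<^sub>2 s\<^sub>1 s\<^sub>2)"
proof -
  let ?T = "T0 r\<^sub>1 r\<^sub>2 s\<^sub>1 s\<^sub>2"
  define M where "M = \<bar>r\<^sub>1\<bar> + \<bar>r\<^sub>2\<bar> + \<bar>s\<^sub>1\<bar> + \<bar>s\<^sub>2\<bar>"
  have M0: "0 \<le> M" by (simp add: M_def)
  define K where "K = (3 * M) powr p"
  have K0: "0 \<le> K" by (simp add: K_def)
  have pt: "norm (?T x n) powr p \<le>
      K * (norm (x (n - 2)) powr p + norm (x n) powr p + norm (x (n + 2)) powr p)" for x n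
  proof -
    define m where "m = max (norm (x (n - 2))) (max (norm (x n)) (norm (x (n + 2))))"
    have m: "norm (x (n - 2)) \<le> m" "norm (x n) \<le> m" "norm (x (n + 2)) \<le> m" "0 \<le> m"
      by (auto simp: m_def le_max_iff_disj)
    have tri: "norm (of_real s * x (n - 2) + of_real r * x n + of_real s * x (n + 2)) \<le> 3 * M * m"
      if "\<bar>s\<bar> \<le> M" "\<bar>r\<bar> \<le> M" for r s
    proof -
      have "norm (of_real s * x (n - 2) + of_real r * x n + of_real s * x (n + 2))
          \<le> norm (of_real s * x (n - 2)) + norm (of_real r * x n) + norm (of_real s * x (n + 2))"
        by (meson norm_triangle_mono norm_triangle_ineq order_refl)
      also have "\<dots> \<le> M * m + M * m + M * m"
        unfolding norm_mult norm_of_real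
        by (intro add_mono mult_mono that m M0) auto
      finally show ?thesis by simp
    qed
    have "norm (?T x n) \<le> 3 * M * m"
      using tri[of s\<^sub>1 r\<^sub>1] tri[of s\<^sub>2 r\<^sub>2] M0 m(4) by (auto simp: T0_def M_def)
    then have "norm (?T x n) powr p \<le> (3 * M * m) powr p"
      using p by (intro powr_mono2) auto
    also have "\<dots> = K * m powr p"
      using M0 m(4) by (simp add: K_def powr_mult)
    also have "m powr p \<le>
        norm (x (n - 2)) powr p + norm (x n) powr p + norm (x (n + 2)) powr p"
      by (auto simp: m_def max_def)
    finally show ?thesis using K0 by (simp add: mult_left_mono)
  qed
  have sums: "summable (\<lambda>n. norm (?T x n) powr p) \<and>
      (\<Sum>n. norm (?T x n) powr p) \<le> 3 * K * (\<Sum>n. norm (x n) powr p)" if x: "x \<in> lp p" for x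
  proof -
    define f where "f = (\<lambda>n. norm (x n) powr p)"
    have f: "summable f" "f 0 = 0" "\<And>n. 0 \<le> f n"
      using x by (auto simp: lp_def f_def)
    have f1: "f (Suc 0 - 2) = 0" using f(2) by simp
    have s2: "summable (\<lambda>n. f (n + 2))"
      using f(1) by (subst summable_iff_shift)
    have e2: "(\<Sum>n. f (n + 2)) \<le> suminf f"
      using suminf_split_initial_segment[OF f(1), of 2] sum_nonneg[of "{..<2}" f] f(3) by simp
    have s1: "summable (\<lambda>n. f (n - 2))"
      using f(1) summable_iff_shift[of "\<lambda>n. f (n - 2)" 2] by simp
    have e1: "(\<Sum>n. f (n - 2)) = suminf f"
      using suminf_split_initial_segment[OF s1, of 2] f(2) by (simp add: numeral_2_eq_2)
    let ?g = "\<lambda>n. K * (f (n - 2) + f n + f (n + 2))"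
    have sg: "summable ?g"
      by (intro summable_mult summable_add s1 s2 f(1))
    have le: "norm (?T x n) powr p \<le> ?g n" for n
      using pt[of x n] by (simp add: f_def)
    have sT: "summable (\<lambda>n. norm (?T x n) powr p)"
      by (rule summable_comparison_test'[OF sg, of 0]) (use le in auto)
    have "(\<Sum>n. norm (?T x n) powr p) \<le> suminf ?g"
      by (rule suminf_le[OF le sT sg])
    also have "\<dots> = K * (suminf f + suminf f + (\<Sum>n. f (n + 2)))"
      using s1 s2 f(1) e1 by (simp add: suminf_mult suminf_add[symmetric] summable_add)
    also have "\<dots> \<le> K * (3 * suminf f)"
      using e2 K0 by (intro mult_left_mono) auto
    finally show ?thesis using sT by (simp add: f_def mult.assoc mult.left_commute)
  qed
  have "?T ` lp p \<subseteq> lp p"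
    using sums by (auto simp: lp_def T0_def)
  moreover have "lp_bounded_on p (lp p) ?T"
    unfolding lp_bounded_on_def
  proof (intro exI ballI)
    fix x assume x: "x \<in> lp p"
    have n0: "0 \<le> (\<Sum>n. norm (?T x n) powr p)" "0 \<le> (\<Sum>n. norm (x n) powr p)"
      using sums[OF x] x by (auto simp: lp_def intro!: suminf_nonneg)
    have "lp_norm p (?T x) \<le> (3 * K * (\<Sum>n. norm (x n) powr p)) powr (1 / p)"
      unfolding lp_norm_def using sums[OF x] n0 p by (intro powr_mono2) auto
    also have "\<dots> = (3 * K) powr (1 / p) * lp_norm p x"
      unfolding lp_norm_def using K0 n0 by (simp add: powr_mult)
    finally show "lp_norm p (?T x) \<le> (3 * K) powr (1 / p) * lp_norm p x" .
  qed
  ultimately show ?thesis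
    unfolding lp_bounded_linear_def by (auto simp: T0_def fun_eq_iff algebra_simps)
qed

end

theory Submission
  imports Defs
begin

text \<open>
  Let \<open>S\<close> be the forward shift by two places, \<open>B\<close> its left inverse, and choose \<open>w\<close>, depending
  only on the parity of the index, with \<open>0 < \<bar>w\<bar> \<le> 1\<close> and \<open>w + 1 / w = (z - r) / s\<close>. Since
  \<open>B S = I\<close>, \<open>T\<^sub>0 - z = -(s / w) (I - w B) (I - w S)\<close>, and \<open>z\<close> lies in one of the two
  intervals iff \<open>\<bar>w\<bar> = 1\<close> for that parity. If \<open>\<bar>w\<bar> < 1\<close> for both parities, both factors are
  onto. For \<open>\<bar>w\<bar> \<le> 1\<close> the operator is always injective, as null sequences with
  \<open>u\<^sub>n = w u\<^sub>n\<^sub>+\<^sub>2\<close> vanish, and always has dense range: a finitely supported \<open>u\<close> is approximated by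
  \<open>(I - w S) x\<close> where \<open>(I - t w S) x = u\<close> and \<open>t \<rightarrow> 1\<close>, with error \<open>O((1 - t)\<^sup>1\<^sup>-\<^sup>1\<^sup>/\<^sup>p)\<close>.
  If \<open>\<bar>w\<bar> = 1\<close> for some parity, the geometric sequence \<open>w\<^sup>k\<close> along that parity is not in
  \<open>\<ell>\<^sub>p\<close>, so a unit vector has no preimage, and its truncations show that the inverse is unbounded.
\<close>

section \<open>Domination, shifts and null sequences in \<open>lp p\<close>\<close>

text \<open>Estimates are made for the p-th power of the norm, since comparison of series gives them
  directly; the root is taken only for the final density and unboundedness claims.\<close>

definition lp_pow :: "real \<Rightarrow> (nat \<Rightarrow> complex) \<Rightarrow> real" where
  "lp_pow p x = (\<Sum>n. norm (x n) powr p)"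

lemma lp_pow_nonneg: "x \<in> lp p \<Longrightarrow> 0 \<le> lp_pow p x"
  by (auto simp: lp_def lp_pow_def intro!: suminf_nonneg)

lemma lp_norm_eq: "lp_norm p x = lp_pow p x powr (1 / p)"
  by (simp add: lp_norm_def lp_pow_def)

text \<open>With m the larger of a and b, (a + b)^p \<le> (2 m)^p \<le> 2^p (a^p + b^p). This stands
  in for the triangle inequality of the p-norm wherever constants do not matter.\<close>

lemma lp_dominated:
  assumes p: "0 < p" and x: "x \<in> lp p" and y: "y \<in> lp p" and K: "0 \<le> K" and z0: "z 0 = 0"
    and le: "\<And>n. norm (z n) \<le> K * (norm (x n) + norm (y n))"
  shows "z \<in> lp p" and "lp_pow p z \<le> (2 * K) powr p * (lp_pow p x + lp_pow p y)"
proof -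
  let ?g = "\<lambda>n. (2 * K) powr p * (norm (x n) powr p + norm (y n) powr p)"
  have sx: "summable (\<lambda>n. norm (x n) powr p)" and sy: "summable (\<lambda>n. norm (y n) powr p)"
    using x y by (auto simp: lp_def)
  have pt: "norm (z n) powr p \<le> ?g n" for n
  proof -
    define m where "m = max (norm (x n)) (norm (y n))"
    have "norm (x n) + norm (y n) \<le> 2 * m" by (auto simp: m_def)
    then have "norm (z n) \<le> 2 * K * m"
      using order_trans[OF le mult_left_mono[OF _ K]] by (metis mult.left_commute mult.assoc)
    then have "norm (z n) powr p \<le> (2 * K * m) powr p"
      using p by (intro powr_mono2) auto
    also have "\<dots> = (2 * K) powr p * m powr p"
      by (rule powr_mult)
    also have "m powr p \<le> norm (x n) powr p + norm (y n) powr p"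
      by (auto simp: m_def max_def)
    finally show ?thesis by (simp add: mult_left_mono)
  qed
  have sg: "summable ?g" by (intro summable_mult summable_add sx sy)
  have sz: "summable (\<lambda>n. norm (z n) powr p)"
    by (rule summable_comparison_test'[OF sg, of 0]) (use pt in auto)
  then show "z \<in> lp p" using z0 by (simp add: lp_def)
  have "lp_pow p z \<le> suminf ?g"
    unfolding lp_pow_def by (rule suminf_le[OF pt sz sg])
  also have "\<dots> = (2 * K) powr p * (lp_pow p x + lp_pow p y)"
    using sx sy by (simp add: lp_pow_def suminf_mult suminf_add summable_add)
  finally show "lp_pow p z \<le> (2 * K) powr p * (lp_pow p x + lp_pow p y)" .
qed

text \<open>This is the backward shift by two. Index 0 is reset because \<open>x 2\<close> would
  land on it.\<close>

lemma lp_shift_up: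
  assumes x: "x \<in> lp p"
  shows "(\<lambda>n. if n = 0 then 0 else x (n + 2)) \<in> lp p"
    and "lp_pow p (\<lambda>n. if n = 0 then 0 else x (n + 2)) \<le> lp_pow p x"
proof -
  let ?y = "\<lambda>n. if n = 0 then 0 else x (n + 2)"
  define f where "f = (\<lambda>n. norm (x n) powr p)"
  have f: "summable f" "\<And>n. 0 \<le> f n"
    using x by (auto simp: lp_def f_def)
  have s2: "summable (\<lambda>n. f (n + 2))"
    using f(1) by (subst summable_iff_shift)
  have le: "norm (?y n) powr p \<le> f (n + 2)" for n by (auto simp: f_def)
  have sy: "summable (\<lambda>n. norm (?y n) powr p)"
    by (rule summable_comparison_test'[OF s2, of 0]) (use le in auto)
  then show "?y \<in> lp p" by (simp add: lp_def)
  have "lp_pow p ?y \<le> (\<Sum>n. f (n + 2))"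
    unfolding lp_pow_def by (rule suminf_le[OF le sy s2])
  also have "\<dots> \<le> suminf f"
    using suminf_split_initial_segment[OF f(1), of 2] sum_nonneg[of "{..<2}" f] f(2) by simp
  finally show "lp_pow p ?y \<le> lp_pow p x" by (simp add: lp_pow_def f_def)
qed

text \<open>Truncated subtraction sends 0, 1 and 2 to index 0, where \<open>x\<close> vanishes, so
  this is the isometric forward shift.\<close>

lemma lp_shift_down:
  assumes x: "x \<in> lp p"
  shows "(\<lambda>n. x (n - 2)) \<in> lp p" and "lp_pow p (\<lambda>n. x (n - 2)) = lp_pow p x"
proof -
  define f where "f = (\<lambda>n. norm (x n) powr p)"
  have f: "summable f" "f 0 = 0" "\<And>n. 0 \<le> f n"
    using x by (auto simp: lp_def f_def)
  have s1: "summable (\<lambda>n. f (n - 2))"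
    using f(1) summable_iff_shift[of "\<lambda>n. f (n - 2)" 2] by simp
  then show "(\<lambda>n. x (n - 2)) \<in> lp p" using x by (simp add: lp_def f_def)
  have "f (Suc 0 - 2) = 0" using f(2) by simp
  then have "(\<Sum>n. f (n - 2)) = suminf f"
    using suminf_split_initial_segment[OF s1, of 2] f(2) by (simp add: numeral_2_eq_2)
  then show "lp_pow p (\<lambda>n. x (n - 2)) = lp_pow p x" by (simp add: lp_pow_def f_def)
qed

lemma lp_tendsto_0:
  assumes "x \<in> lp p" and "0 < p"
  shows "x \<longlonglongrightarrow> 0"
proof -
  have "(\<lambda>n. norm (x n) powr p) \<longlonglongrightarrow> 0"
    using assms by (auto simp: lp_def intro: summable_LIMSEQ_zero)
  from tendsto_zero_powrI[OF this tendsto_const[of "1 / p"]]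
  have "(\<lambda>n. (norm (x n) powr p) powr (1 / p)) \<longlonglongrightarrow> 0"
    using assms(2) by simp
  then have "(\<lambda>n. norm (x n)) \<longlonglongrightarrow> 0"
    using assms(2) by (simp add: powr_powr)
  then show ?thesis by (rule tendsto_norm_zero_cancel)
qed

section \<open>Summability of sequences bounded recursively by their shifts\<close>

text \<open>Summing \<open>le\<close> over n < N bounds the partial sum by q times itself plus a
  constant; being finite, it can be absorbed on the left. In the uses \<open>h\<close> is
  \<open>f\<close> shifted by two, and \<open>B\<close> pays for the terms that enter at the
  boundary.\<close>

lemma summable_bounded_sums:
  fixes f :: "nat \<Rightarrow> real"
  assumes f0: "\<And>n. 0 \<le> f n" and g0: "\<And>n. 0 \<le> g n" and g: "summable g"
    and q: "0 \<le> q" "q < 1"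
    and le: "\<And>n. f n \<le> g n + q * h n"
    and h: "\<And>N. (\<Sum>n<N. h n) \<le> (\<Sum>n<N. f n) + B"
  shows "summable f" and "B = 0 \<Longrightarrow> suminf f \<le> suminf g / (1 - q)"
proof -
  have bd: "(\<Sum>n<N. f n) \<le> (suminf g + q * B) / (1 - q)" for N
  proof -
    have "(\<Sum>n<N. f n) \<le> (\<Sum>n<N. g n) + q * (\<Sum>n<N. h n)"
      using sum_mono[of "{..<N}" f "\<lambda>n. g n + q * h n"] le by (simp add: sum.distrib sum_distrib_left)
    also have "\<dots> \<le> suminf g + q * ((\<Sum>n<N. f n) + B)"
      using q(1) h[of N] g g0 by (intro add_mono mult_left_mono sum_le_suminf) auto
    finally have "(\<Sum>n<N. f n) * (1 - q) \<le> suminf g + q * B" by (simp add: algebra_simps)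
    then show ?thesis using q by (simp add: pos_le_divide_eq)
  qed
  show s: "summable f"
    by (rule summableI_nonneg_bounded[OF f0 bd])
  show "suminf f \<le> suminf g / (1 - q)" if "B = 0"
    using suminf_le_const[OF s bd] that by simp
qed

lemma sum_shift_down_le:
  fixes f :: "nat \<Rightarrow> real"
  assumes "\<And>n. 0 \<le> f n" and "f 0 = 0"
  shows "(\<Sum>n<N. f (n - 2)) \<le> (\<Sum>n<N. f n)"
proof (induction N)
  case (Suc N)
  show ?case
  proof (cases "N \<le> 2")
    case True
    then have "n < Suc N \<Longrightarrow> f (n - 2) = 0" for n using assms(2) by simp
    then have "(\<Sum>n<Suc N. f (n - 2)) = 0" by (simp del: sum.lessThan_Suc)
    then show ?thesis using assms(1) by (simp add: sum_nonneg)
  next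
    case False
    have "(\<Sum>n<Suc N. f (n - 2)) = (\<Sum>n<Suc (Suc (N - 1)). f (n - 2))" using False by simp
    also have "\<dots> = (\<Sum>n<N - 1. f n)"
      using assms(2) by (simp only: sum.lessThan_Suc_shift) simp
    also have "\<dots> \<le> (\<Sum>n<Suc N. f n)" using assms(1) by (intro sum_mono2) auto
    finally show ?thesis .
  qed
qed simp

text \<open>Moving the window to the right brings in only the terms at \<open>N\<close> and
  \<open>Suc N\<close>, each at most \<open>B\<close>.\<close>

lemma sum_shift_up_le:
  fixes f :: "nat \<Rightarrow> real"
  assumes "\<And>n. 0 \<le> f n" and "\<And>n. f n \<le> B"
  shows "(\<Sum>n<N. f (n + 2)) \<le> (\<Sum>n<N. f n) + 2 * B"
proof -
  have "(\<Sum>n<N. f (n + 2)) \<le> f 0 + f 1 + (\<Sum>n<N. f (n + 2))" using assms(1) by simp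
  also have "\<dots> = (\<Sum>n<Suc (Suc N). f n)"
    by (simp only: sum.lessThan_Suc_shift) simp
  also have "\<dots> \<le> (\<Sum>n<N. f n) + 2 * B"
    using assms(2)[of N] assms(2)[of "Suc N"] by simp
  finally show ?thesis .
qed

text \<open>Replaces Minkowski's inequality in the recursions below: the factor at \<open>b\<close> stays below 1.\<close>

lemma powr_le_contraction:
  fixes a b c p q :: real
  assumes p: "1 < p" and ab: "0 \<le> a" "0 \<le> b" and q: "0 \<le> q" "q < 1" and c: "0 \<le> c" "c \<le> a + q * b"
  shows "c powr p \<le> (1 + 2 / (1 - q)) powr p * a powr p + (1 + q) / 2 * b powr p"
proof (cases "b \<le> 2 / (1 - q) * a")
  case True
  have "q * b \<le> 1 * b" using ab q by (intro mult_right_mono) auto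
  then have "c \<le> (1 + 2 / (1 - q)) * a" using True c by (simp add: algebra_simps)
  then have "c powr p \<le> ((1 + 2 / (1 - q)) * a) powr p"
    using p c by (intro powr_mono2) auto
  then show ?thesis using q by (simp add: powr_mult add_increasing2)
next
  case False
  \<comment> \<open>The threshold of the case split is chosen so that here \<open>a + q * b\<close>
    is at most \<open>(1 + q) / 2 * b\<close>, with a factor still below 1.\<close>
  then have "a \<le> (1 - q) / 2 * b" using q by (simp add: field_simps)
  then have "c \<le> (1 + q) / 2 * b" using c by (simp add: field_simps)
  then have "c powr p \<le> ((1 + q) / 2 * b) powr p"
    using p c by (intro powr_mono2) auto
  also have "\<dots> = ((1 + q) / 2) powr p * b powr p" by (rule powr_mult)
  also have "\<dots> \<le> (1 + q) / 2 * b powr p"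
    using powr_mono'[of 1 p "(1 + q) / 2"] p q by (intro mult_right_mono) auto
  finally show ?thesis by (simp add: add_increasing)
qed


section \<open>The factors I - w S and I - w B\<close>

text \<open>The factor I - w S; for n = 1 the truncated \<open>n - 2\<close> is 0, where the
  sequences in \<open>lp p\<close> vanish.\<close>

definition fwd_diff :: "(nat \<Rightarrow> complex) \<Rightarrow> (nat \<Rightarrow> complex) \<Rightarrow> nat \<Rightarrow> complex" where
  "fwd_diff w x n = x n - w n * x (n - 2)"

text \<open>The factor I - w B, with index 0 reset so that the result vanishes there.\<close>

definition bwd_diff :: "(nat \<Rightarrow> complex) \<Rightarrow> (nat \<Rightarrow> complex) \<Rightarrow> nat \<Rightarrow> complex" where
  "bwd_diff w x n = (if n = 0 then 0 else x n - w n * x (n + 2))"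

text \<open>As B S = I and a 2-periodic \<open>w\<close> commutes with B, (I - w B)(I - w S) = (1 +
  w^2) I - w (S + B).\<close>

lemma bwd_fwd_diff:
  assumes "\<And>n. w (n + 2) = w n" and "n \<noteq> 0"
  shows "bwd_diff w (fwd_diff w x) n = (1 + (w n)\<^sup>2) * x n - w n * (x (n - 2) + x (n + 2))"
  using assms(1)[of n] assms(2) by (simp add: bwd_diff_def fwd_diff_def algebra_simps power2_eq_square)

lemma fwd_diff_in_lp:
  assumes p: "0 < p" and w: "\<And>n. norm (w n) \<le> 1" and x: "x \<in> lp p"
  shows "fwd_diff w x \<in> lp p"
proof (rule lp_dominated(1)[OF p x lp_shift_down(1)[OF x], where K = 1])
  show "fwd_diff w x 0 = 0" using x by (simp add: fwd_diff_def lp_def)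
  fix n
  have "norm (w n * x (n - 2)) \<le> norm (x (n - 2))"
    using w[of n] by (simp add: norm_mult mult_left_le_one_le)
  then show "norm (fwd_diff w x n) \<le> 1 * (norm (x n) + norm (x (n - 2)))"
    using norm_triangle_ineq4[of "x n" "w n * x (n - 2)"] by (simp add: fwd_diff_def)
qed simp

lemma bwd_diff_bounded:
  assumes p: "0 < p" and w: "\<And>n. norm (w n) \<le> 1" and x: "x \<in> lp p"
  shows "bwd_diff w x \<in> lp p" and "lp_pow p (bwd_diff w x) \<le> 2 powr p * (2 * lp_pow p x)"
proof -
  let ?y = "\<lambda>n. if n = 0 then 0 else x (n + 2)"
  have 0: "bwd_diff w x 0 = 0" by (simp add: bwd_diff_def)
  have le: "norm (bwd_diff w x n) \<le> 1 * (norm (x n) + norm (?y n))" for n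
  proof -
    have "norm (w n * x (n + 2)) \<le> norm (x (n + 2))"
      using w[of n] by (simp add: norm_mult mult_left_le_one_le)
    then show ?thesis
      using norm_triangle_ineq4[of "x n" "w n * x (n + 2)"] by (simp add: bwd_diff_def)
  qed
  note * = lp_dominated[OF p x lp_shift_up(1)[OF x], where K = 1, OF _ 0 le]
  show "bwd_diff w x \<in> lp p" by (rule *(1)) simp
  have "lp_pow p (bwd_diff w x) \<le> (2 * 1) powr p * (lp_pow p x + lp_pow p ?y)"
    by (rule *(2)) simp
  also have "\<dots> \<le> 2 powr p * (2 * lp_pow p x)"
    using lp_shift_up(2)[OF x] by (simp add: mult_left_mono)
  finally show "lp_pow p (bwd_diff w x) \<le> 2 powr p * (2 * lp_pow p x)" .
qed

text \<open>Forward substitution, possible because I - w S is lower triangular. Whether the solution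
  lies in \<open>lp p\<close> is a separate question.\<close>

fun fwd_solution :: "(nat \<Rightarrow> complex) \<Rightarrow> (nat \<Rightarrow> complex) \<Rightarrow> nat \<Rightarrow> complex" where
  "fwd_solution w y 0 = 0"
| "fwd_solution w y (Suc 0) = y 1"
| "fwd_solution w y (Suc (Suc n)) = y (Suc (Suc n)) + w (Suc (Suc n)) * fwd_solution w y n"

lemma fwd_diff_solution:
  assumes "y 0 = 0"
  shows "fwd_diff w (fwd_solution w y) = y"
proof
  fix n
  show "fwd_diff w (fwd_solution w y) n = y n"
    using assms by (cases "(w, y, n)" rule: fwd_solution.cases) (auto simp: fwd_diff_def)
qed

text \<open>Since |x n| \<le> |y n| + q |x (n - 2)|, \<open>powr_le_contraction\<close> gives a
  recursion for the p-th powers with factor (1 + q) / 2 < 1, and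
  \<open>summable_bounded_sums\<close> makes them summable.\<close>

lemma fwd_diff_surj:
  assumes p: "1 < p" and q: "0 \<le> q" "q < 1" and w: "\<And>n. norm (w n) \<le> q" and y: "y \<in> lp p"
  shows "\<exists>x\<in>lp p. fwd_diff w x = y"
proof (rule bexI)
  define x where "x = fwd_solution w y"
  have x0: "x 0 = 0" by (simp add: x_def)
  show eq: "fwd_diff w x = y"
    using y by (auto simp: x_def lp_def intro: fwd_diff_solution)
  define q' where "q' = (1 + q) / 2"
  have q': "0 \<le> q'" "q' < 1" using q by (auto simp: q'_def)
  let ?f = "\<lambda>n. norm (x n) powr p"
  let ?g = "\<lambda>n. (1 + 2 / (1 - q)) powr p * norm (y n) powr p"
  have sy: "summable ?g" using y by (auto simp: lp_def intro: summable_mult)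
  have le: "?f n \<le> ?g n + q' * ?f (n - 2)" for n
  proof -
    have "norm (x n) \<le> norm (y n) + norm (w n * x (n - 2))"
      using norm_triangle_ineq[of "y n" "w n * x (n - 2)"] fun_cong[OF eq, of n]
      by (simp add: fwd_diff_def algebra_simps)
    also have "norm (w n * x (n - 2)) \<le> q * norm (x (n - 2))"
      using w by (simp add: norm_mult mult_right_mono)
    finally show ?thesis
      using powr_le_contraction[OF p _ _ q, of "norm (y n)" "norm (x (n - 2))" "norm (x n)"]
      by (simp add: q'_def)
  qed
  have "summable ?f"
  proof (rule summable_bounded_sums(1)[OF _ _ sy q' le])
    show "(\<Sum>n<N. ?f (n - 2)) \<le> (\<Sum>n<N. ?f n) + 0" for N
      using sum_shift_down_le[of ?f N] x0 by simp
  qed auto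
  then show "x \<in> lp p" using x0 by (simp add: lp_def)
qed

lemma lp_zero: "(\<lambda>_. 0) \<in> lp p" "lp_pow p (\<lambda>_. 0) = 0"
  by (auto simp: lp_def lp_pow_def)

section \<open>Approximation by the range of I - w S for |w| \<le> 1\<close>

text \<open>If (I - t w S) x = u and d = 1 - t, then (I - w S) x - u = -d w S x. With the bound D /
  d on the p-th power norm of \<open>x\<close>, the error is at most (2 d)^p D / d, which tends to 0
  with d as p > 1.\<close>

lemma fwd_diff_dense:
  assumes p: "1 < p" and w: "\<And>n. norm (w n) \<le> 1" and u: "u \<in> lp p" and M: "\<And>n. M < n \<Longrightarrow> u n = 0"
    and e: "0 < e"
  shows "\<exists>x\<in>lp p. lp_pow p (\<lambda>n. fwd_diff w x n - u n) < e"
proof -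
  \<comment> \<open>Unrolling the recursion for the \<open>x\<close> obtained below, with
    coefficients of modulus at most 1, bounds every |x n| by \<open>B\<close>.\<close>
  define B where "B = (\<Sum>k\<le>M. norm (u k))"
  \<comment> \<open>\<open>g\<close> replaces the contraction at the indices up to \<open>M\<close>,
    where \<open>u\<close> may be nonzero.\<close>
  define g where "g = (\<lambda>n. if n \<in> {..M} then B powr p else 0)"
  have sg: "summable g" unfolding g_def by (rule summable_If_finite_set) simp
  define D where "D = suminf g"
  \<comment> \<open>This is the final error bound as a function of d = 1 - t; the positive exponent
    p - 1 makes it vanish in the limit.\<close>
  have "((\<lambda>d. 2 powr p * D * d powr (p - 1)) \<longlongrightarrow> 2 powr p * D * 0) (at_right 0)"
    using p
    by (intro tendsto_mult tendsto_const tendsto_zero_powrI[where b = "p - 1"] tendsto_ident_at)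
       (auto simp: eventually_at_right_less intro: eventually_mono[OF eventually_at_right_less])
  then have "\<forall>\<^sub>F d in at_right 0. 2 powr p * D * d powr (p - 1) < e"
    using e by (intro order_tendstoD) auto
  moreover have "\<forall>\<^sub>F d in at_right (0::real). 0 < d" by (rule eventually_at_right_less)
  moreover have "\<forall>\<^sub>F d in at_right (0::real). d < 1"
    by (rule eventually_at_right_real[of 0 1, THEN eventually_mono]) auto
  ultimately have "\<forall>\<^sub>F d in at_right 0. 2 powr p * D * d powr (p - 1) < e \<and> 0 < d \<and> d < 1"
    by eventually_elim auto
  then obtain d where d: "2 powr p * D * d powr (p - 1) < e" "0 < d" "d < 1"
    using eventually_happens'[OF trivial_limit_at_right_real] by blast
  define t where "t = 1 - d"
  \<comment> \<open>Past the support of \<open>u\<close> the solution \<open>x\<close> decays geometrically, whence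
    \<open>lp_pow p x \<le> D / d\<close>, which beats the general bound of order \<open>d powr - p\<close>.\<close>
  have t: "0 \<le> t" "t < 1" using d by (auto simp: t_def)
  define v where "v = (\<lambda>n. of_real t * w n)"
  have v: "norm (v n) \<le> t" for n using w[of n] t by (simp add: v_def norm_mult mult_left_le)
  obtain x where x: "x \<in> lp p" and eq: "fwd_diff v x = u"
    by (rule bexE[OF fwd_diff_surj[OF p t v u]])
  have x0: "x 0 = 0" using x by (simp add: lp_def)
  have rec: "x n = u n + v n * x (n - 2)" for n
    using fun_cong[OF eq, of n] by (simp add: fwd_diff_def algebra_simps)
  have v1: "norm (v n * x k) \<le> t * norm (x k)" for n k
    using v[of n] by (simp add: norm_mult mult_right_mono)
  have xB0: "norm (x n) \<le> (\<Sum>k\<le>n. norm (u k))" for n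
  proof (induction n rule: less_induct)
    case (less n)
    show ?case
    proof (cases "n = 0")
      case False
      have "norm (x n) \<le> norm (u n) + norm (v n * x (n - 2))"
        by (subst rec) (rule norm_triangle_ineq)
      also have "\<dots> \<le> norm (u n) + norm (x (n - 2))"
        using v1[of n "n - 2"] mult_right_mono[of t 1 "norm (x (n - 2))"] t by simp
      also have "\<dots> \<le> norm (u n) + (\<Sum>k\<le>n - 2. norm (u k))"
        using less[of "n - 2"] False by simp
      also have "\<dots> = (\<Sum>k\<in>insert n {..n - 2}. norm (u k))" using False by simp
      also have "\<dots> \<le> (\<Sum>k\<le>n. norm (u k))" by (intro sum_mono2) auto
      finally show ?thesis .
    qed (simp add: x0)
  qed
  have xB: "norm (x n) \<le> B" for n
  proof -
    have "(\<Sum>k\<le>n. norm (u k)) = (\<Sum>k\<in>{..n} \<inter> {..M}. norm (u k))"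
      by (rule sum.mono_neutral_right) (auto, meson M not_less)
    also have "\<dots> \<le> B" unfolding B_def by (intro sum_mono2) auto
    finally show ?thesis using xB0[of n] by linarith
  qed
  let ?f = "\<lambda>n. norm (x n) powr p"
  have f: "?f n \<le> g n + t * ?f (n - 2)" for n
  proof (cases "n \<le> M")
    case True
    have "?f n \<le> B powr p" using p xB by (intro powr_mono2) auto
    then show ?thesis using True t by (simp add: g_def add_increasing2)
  next
    case False
    have "?f n \<le> (t * norm (x (n - 2))) powr p"
      using v1[of n "n - 2"] rec[of n] M[of n] False p by (intro powr_mono2) auto
    also have "\<dots> = t powr p * ?f (n - 2)" by (rule powr_mult)
    also have "\<dots> \<le> t * ?f (n - 2)"
      using powr_mono'[of 1 p t] p t by (intro mult_right_mono) auto
    finally show ?thesis using False by (simp add: g_def)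
  qed
  have "suminf ?f \<le> suminf g / (1 - t)"
  proof (rule summable_bounded_sums(2)[OF _ _ sg t f])
    show "(\<Sum>n<N. ?f (n - 2)) \<le> (\<Sum>n<N. ?f n) + 0" for N
      using sum_shift_down_le[of ?f N] x0 by simp
  qed (auto simp: g_def)
  then have xD: "lp_pow p x \<le> D / d" by (simp add: lp_pow_def D_def t_def)
  have err: "fwd_diff w x n - u n = - of_real d * w n * x (n - 2)" for n
    using rec[of n] by (simp add: fwd_diff_def v_def t_def algebra_simps)
  show ?thesis
  proof (rule bexI[OF _ x])
    have "lp_pow p (\<lambda>n. fwd_diff w x n - u n)
        \<le> (2 * d) powr p * (lp_pow p (\<lambda>n. x (n - 2)) + lp_pow p (\<lambda>_. 0))"
    proof (rule lp_dominated(2)[OF _ lp_shift_down(1)[OF x] lp_zero(1)])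
      show "norm (fwd_diff w x n - u n) \<le> d * (norm (x (n - 2)) + norm (0::complex))" for n
        unfolding err using w[of n] d mult_right_mono[of "norm (w n)" 1 "norm (x (n - 2))"]
        by (simp add: norm_mult mult.assoc mult_left_mono)
    qed (use p d x0 err[of 0] in auto)
    also have "\<dots> = (2 * d) powr p * lp_pow p x"
      using lp_shift_down(2)[OF x] lp_zero(2) by simp
    also have "\<dots> \<le> (2 * d) powr p * (D / d)" using xD by (intro mult_left_mono) auto
    also have "\<dots> = 2 powr p * D * d powr (p - 1)"
      using d by (simp add: powr_mult powr_diff)
    finally show "lp_pow p (\<lambda>n. fwd_diff w x n - u n) < e" using d(1) by simp
  qed
qed

section \<open>Solving (I - w B) u = y\<close>

text \<open>The Neumann series, the sum of w^j B^j y: splitting off j = 0 leaves \<open>w n\<close>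
  times the series at n + 2, because \<open>w\<close> has period 2.\<close>

lemma bwd_diff_suminf:
  assumes w: "\<And>n. w (n + 2) = w n" and y: "y 0 = 0"
    and s: "\<And>n. summable (\<lambda>j. w n ^ j * y (n + 2 * j))"
  shows "bwd_diff w (\<lambda>n. if n = 0 then 0 else \<Sum>j. w n ^ j * y (n + 2 * j)) = y"
proof
  fix n
  have "(\<Sum>j. w n ^ j * y (n + 2 * j)) = y n + (\<Sum>j. w n * (w n ^ j * y (n + 2 + 2 * j)))"
    using suminf_split_head[OF s[of n]] by (simp add: mult.assoc algebra_simps)
  also have "(\<Sum>j. w n * (w n ^ j * y (n + 2 + 2 * j))) = w n * (\<Sum>j. w n ^ j * y (n + 2 + 2 * j))"
    using s[of "n + 2"] by (intro suminf_mult) (simp only: w)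
  finally show "bwd_diff w (\<lambda>n. if n = 0 then 0 else \<Sum>j. w n ^ j * y (n + 2 * j)) n = y n"
    using y w[of n] by (simp add: bwd_diff_def)
qed

text \<open>The Neumann series is a finite sum here, even when |w| = 1, and it vanishes past
  \<open>M\<close>. This supplies the finitely supported \<open>u\<close> to which
  \<open>fwd_diff_dense\<close> applies.\<close>

lemma bwd_diff_surj_finite_support:
  assumes w: "\<And>n. w (n + 2) = w n" and y: "y 0 = 0" and M: "\<And>n. M < n \<Longrightarrow> y n = 0"
  shows "\<exists>u\<in>lp p. (\<forall>n>M. u n = 0) \<and> bwd_diff w u = y"
proof -
  define u where "u = (\<lambda>n. if n = 0 then 0 else \<Sum>j. w n ^ j * y (n + 2 * j))"
  have "bwd_diff w u = y"
    unfolding u_def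
    by (rule bwd_diff_suminf[where w = w and y = y, OF w y]) (rule summable_finite[of "{..M}"], auto simp: M)
  moreover have u0: "u n = 0" if "M < n" for n using that by (simp add: u_def M)
  moreover have "u \<in> lp p"
  proof -
    have "summable (\<lambda>n. norm (u n) powr p)"
      by (rule summable_finite[of "{..M}"]) (auto simp: u0)
    then show ?thesis by (simp add: lp_def) (simp add: u_def)
  qed
  ultimately show ?thesis by blast
qed

text \<open>A sequence in \<open>lp p\<close> is bounded, so the Neumann series converges
  geometrically. That its sum lies in \<open>lp p\<close> follows from |u n| \<le> |y n| + q |u (n +
  2)|, as for the forward factor.\<close>

lemma bwd_diff_surj:
  assumes p: "1 < p" and q: "0 \<le> q" "q < 1" and w: "\<And>n. w (n + 2) = w n" and wq: "\<And>n. norm (w n) \<le> q"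
    and y: "y \<in> lp p"
  shows "\<exists>u\<in>lp p. bwd_diff w u = y"
proof (rule bexI)
  define u where "u = (\<lambda>n. if n = 0 then 0 else \<Sum>j. w n ^ j * y (n + 2 * j))"
  have "Bseq y" using lp_tendsto_0[OF y] p by (intro convergent_imp_Bseq convergentI) auto
  then obtain B where B: "0 < B" "\<And>n. norm (y n) \<le> B" by (auto simp: Bseq_def)
  have le: "norm (w n ^ j * y (n + 2 * j)) \<le> B * q ^ j" for n j
    using B wq[of n] q mult_mono[of "norm (w n) ^ j" "q ^ j" "norm (y (n + 2 * j))" B]
    by (simp add: norm_mult norm_power power_mono mult.commute)
  have sq: "summable (\<lambda>j. B * q ^ j)"
    using q by (intro summable_mult summable_geometric) auto
  have sn: "summable (\<lambda>j. norm (w n ^ j * y (n + 2 * j)))" for n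
    by (rule summable_comparison_test'[OF sq, of 0]) (use le in auto)
  then have s: "summable (\<lambda>j. w n ^ j * y (n + 2 * j))" for n
    by (rule summable_norm_cancel)
  show eq: "bwd_diff w u = y"
    unfolding u_def using y by (intro bwd_diff_suminf[OF w _ s]) (simp add: lp_def)
  \<comment> \<open>A uniform bound on \<open>u\<close> comes first: the upward shift brings new
    terms into the partial sums, and \<open>B'\<close> controls them.\<close>
  define B' where "B' = (\<Sum>j. B * q ^ j)"
  have B'0: "0 \<le> B'" unfolding B'_def using B q by (intro suminf_nonneg sq) auto
  have uB: "norm (u n) \<le> B'" for n
  proof (cases "n = 0")
    case False
    have "norm (\<Sum>j. w n ^ j * y (n + 2 * j)) \<le> (\<Sum>j. norm (w n ^ j * y (n + 2 * j)))"
      by (rule summable_norm[OF sn])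
    also have "\<dots> \<le> B'" unfolding B'_def by (rule suminf_le[OF le sn sq])
    finally show ?thesis using False by (simp add: u_def)
  qed (simp add: u_def B'0)
  define q' where "q' = (1 + q) / 2"
  have q': "0 \<le> q'" "q' < 1" using q by (auto simp: q'_def)
  let ?f = "\<lambda>n. norm (u n) powr p"
  let ?g = "\<lambda>n. (1 + 2 / (1 - q)) powr p * norm (y n) powr p"
  have sy: "summable ?g" using y by (auto simp: lp_def intro: summable_mult)
  have f: "?f n \<le> ?g n + q' * ?f (n + 2)" for n
  proof (cases "n = 0")
    case False
    have "norm (u n) \<le> norm (y n) + norm (w n * u (n + 2))"
      using norm_triangle_ineq[of "y n" "w n * u (n + 2)"] fun_cong[OF eq, of n] False
      by (simp add: bwd_diff_def algebra_simps)
    also have "norm (w n * u (n + 2)) \<le> q * norm (u (n + 2))"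
      using wq by (simp add: norm_mult mult_right_mono)
    finally show ?thesis
      using powr_le_contraction[OF p _ _ q, of "norm (y n)" "norm (u (n + 2))" "norm (u n)"]
      by (simp add: q'_def)
  qed (use q' in \<open>simp add: u_def\<close>)
  have "summable ?f"
  proof (rule summable_bounded_sums(1)[OF _ _ sy q' f])
    show "(\<Sum>n<N. ?f (n + 2)) \<le> (\<Sum>n<N. ?f n) + 2 * B' powr p" for N
      using uB p by (intro sum_shift_up_le powr_mono2) auto
  qed auto
  then show "u \<in> lp p" by (simp add: lp_def) (simp add: u_def)
qed


section \<open>Injectivity of the two factors, and truncation\<close>

lemma eq_0_if_norm_le_tendsto_0:
  fixes e :: "nat \<Rightarrow> complex"
  assumes lim: "e \<longlonglongrightarrow> 0" and le: "\<And>n. m \<le> n \<Longrightarrow> norm (e n) \<le> norm (e (n + 2))" and n: "m \<le> n"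
  shows "e n = 0"
proof -
  have "norm (e n) \<le> norm (e (n + 2 * k))" for k
  proof (induction k)
    case (Suc k)
    then show ?case using le[of "n + 2 * k"] n by (simp add: algebra_simps)
  qed simp
  moreover have "strict_mono (\<lambda>k. n + 2 * k)" by (simp add: strict_mono_def)
  then have "(\<lambda>k. norm (e (n + 2 * k))) \<longlonglongrightarrow> 0"
    using LIMSEQ_subseq_LIMSEQ[OF lim] by (auto simp: o_def intro: tendsto_norm_zero)
  ultimately have "norm (e n) \<le> 0" by (intro LIMSEQ_le_const) auto
  then show ?thesis by simp
qed

text \<open>The difference satisfies \<open>e k = w k * e (k + 2)\<close>, so its norms do not
  decrease in steps of two, yet they tend to 0. Assuming agreement only from \<open>m\<close> on
  lets this serve both injectivity and the study of solutions past a given index.\<close>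

lemma bwd_diff_cancel:
  assumes p: "0 < p" and w: "\<And>n. norm (w n) \<le> 1" and u: "u \<in> lp p" and v: "v \<in> lp p"
    and eq: "\<And>n. m \<le> n \<Longrightarrow> bwd_diff w u n = bwd_diff w v n" and n: "m \<le> n"
  shows "u n = v n"
proof (cases "n = 0")
  case False
  define e where "e = (\<lambda>n. u n - v n)"
  have "e \<longlonglongrightarrow> 0"
    using tendsto_diff[OF lp_tendsto_0[OF u p] lp_tendsto_0[OF v p]] by (simp add: e_def)
  moreover have "norm (e k) \<le> norm (e (k + 2))" if k: "n \<le> k" for k
  proof -
    have "e k = w k * e (k + 2)"
      using eq[of k] n k False by (simp add: bwd_diff_def e_def algebra_simps)
    then show ?thesis using w[of k] by (simp add: norm_mult mult_left_le_one_le)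
  qed
  ultimately have "e n = 0" by (rule eq_0_if_norm_le_tendsto_0[of e n n]) auto
  then show ?thesis by (simp add: e_def)
qed (use u v in \<open>simp add: lp_def\<close>)

lemma fwd_diff_cancel:
  assumes "x 0 = 0" and "y 0 = 0" and eq: "fwd_diff w x = fwd_diff w y"
  shows "x = y"
proof
  fix n
  show "x n = y n"
  proof (induction n rule: less_induct)
    case (less n)
    show ?case
    proof (cases "n = 0")
      case False
      then show ?thesis using less[of "n - 2"] fun_cong[OF eq, of n] by (simp add: fwd_diff_def)
    qed (simp add: assms)
  qed
qed

lemma lp_truncate:
  assumes p: "0 < p" and y: "y \<in> lp p" and e: "0 < e"
  obtains M where "(\<lambda>n. if n < M then 0 else y n) \<in> lp p"
    and "lp_pow p (\<lambda>n. if n < M then 0 else y n) < e"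
proof -
  define f where "f = (\<lambda>n. norm (y n) powr p)"
  have f: "summable f" using y by (simp add: f_def lp_def)
  have "(\<lambda>N. \<Sum>n<N. f n) \<longlonglongrightarrow> suminf f" by (rule summable_LIMSEQ[OF f])
  then have "\<forall>\<^sub>F N in sequentially. suminf f - e < (\<Sum>n<N. f n)"
    using e by (intro order_tendstoD) auto
  then obtain M where M: "suminf f - e < (\<Sum>n<M. f n)"
    by (auto simp: eventually_sequentially)
  let ?y = "\<lambda>n. if n < M then 0 else y n"
  have "(\<lambda>n. f n - (if n \<in> {..<M} then f n else 0)) sums (suminf f - (\<Sum>n<M. f n))"
    by (intro sums_diff summable_sums[OF f] sums_If_finite_set) simp
  also have "(\<lambda>n. f n - (if n \<in> {..<M} then f n else 0)) = (\<lambda>n. norm (?y n) powr p)"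
    by (auto simp: f_def fun_eq_iff)
  finally have *: "(\<lambda>n. norm (?y n) powr p) sums (suminf f - (\<Sum>n<M. f n))" .
  show thesis
  proof (rule that)
    show "?y \<in> lp p" using * y by (simp add: lp_def sums_iff)
    show "lp_pow p ?y < e" using * M by (simp add: lp_pow_def sums_iff)
  qed
qed

section \<open>Operators of the form c (I - w B)(I - w S)\<close>

text \<open>\<open>L\<close> stands for T0 - z. The constant \<open>K\<close> bounds
  \<open>c\<close> and its inverse, so multiplication by \<open>c\<close> is an isomorphism of
  \<open>lp p\<close>.\<close>

locale shift_factorization =
  fixes p K :: real and w c :: "nat \<Rightarrow> complex" and L :: "(nat \<Rightarrow> complex) \<Rightarrow> nat \<Rightarrow> complex"
  assumes p: "1 < p"
    and w_periodic: "\<And>n. w (n + 2) = w n" and w_le: "\<And>n. norm (w n) \<le> 1"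
    and c: "\<And>n. c n \<noteq> 0" "\<And>n. norm (c n) \<le> K" "\<And>n. norm (inverse (c n)) \<le> K"
    and L: "\<And>x n. x \<in> lp p \<Longrightarrow> L x n = c n * bwd_diff w (fwd_diff w x) n"
begin

lemma p_pos: "0 < p" using p by simp

lemma K_nonneg: "0 \<le> K"
  using c(2)[of 0] norm_ge_zero[of "c 0"] by linarith

lemmas fwd_in_lp = fwd_diff_in_lp[where w = w, OF p_pos w_le]
lemmas bwd_bounded = bwd_diff_bounded[where w = w, OF p_pos w_le]

text \<open>The bound is in terms of \<open>fwd_diff w x\<close> and not of \<open>x\<close>,
  because \<open>fwd_diff w x\<close> is what stays bounded on the approximate eigenvectors.\<close>

lemma L_bounded:
  assumes x: "x \<in> lp p"
  shows "L x \<in> lp p"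
    and "lp_pow p (L x) \<le> (2 * K) powr p * (2 powr p * (2 * lp_pow p (fwd_diff w x)))"
proof -
  note u = bwd_bounded[OF fwd_in_lp[OF x]]
  have L0: "L x 0 = 0" by (simp add: L[OF x] bwd_diff_def)
  have le: "norm (L x n) \<le> K * (norm (bwd_diff w (fwd_diff w x) n) + norm (0::complex))" for n
    using c(2) by (simp add: L[OF x] norm_mult mult_right_mono)
  note * = lp_dominated[OF p_pos u(1) lp_zero(1) K_nonneg L0 le]
  show "L x \<in> lp p" by (rule *(1))
  have "lp_pow p (L x) \<le> (2 * K) powr p * (lp_pow p (bwd_diff w (fwd_diff w x)) + lp_pow p (\<lambda>_. 0))"
    by (rule *(2))
  also have "\<dots> \<le> (2 * K) powr p * (2 powr p * (2 * lp_pow p (fwd_diff w x)))"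
    using u(2) by (intro mult_left_mono) (auto simp: lp_zero(2))
  finally show "lp_pow p (L x) \<le> (2 * K) powr p * (2 powr p * (2 * lp_pow p (fwd_diff w x)))" .
qed

lemma L_inj: "inj_on L (lp p)"
proof (rule inj_onI)
  fix x y assume x: "x \<in> lp p" and y: "y \<in> lp p" and eq: "L x = L y"
  have "bwd_diff w (fwd_diff w x) n = bwd_diff w (fwd_diff w y) n" for n
    using fun_cong[OF eq, of n] c(1)[of n] by (simp add: L x y)
  then have "fwd_diff w x n = fwd_diff w y n" for n
    using bwd_diff_cancel[where w = w, OF p_pos w_le fwd_in_lp[OF x] fwd_in_lp[OF y], where m = 0] by blast
  then show "x = y" using x y by (intro fwd_diff_cancel[of x y w]) (auto simp: lp_def)
qed

text \<open>The three factors are inverted in turn: division by \<open>c\<close>, then I - w B, then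
  I - w S.\<close>

lemma L_surj:
  assumes q: "0 \<le> q" "q < 1" and wq: "\<And>n. norm (w n) \<le> q"
  shows "L ` lp p = lp p"
proof
  show "L ` lp p \<subseteq> lp p" using L_bounded(1) by auto
  show "lp p \<subseteq> L ` lp p"
  proof
    fix y assume y: "y \<in> lp p"
    define v where "v = (\<lambda>n. inverse (c n) * y n)"
    have "v \<in> lp p"
    proof (rule lp_dominated(1)[OF p_pos y lp_zero(1) K_nonneg])
      show "v 0 = 0" using y by (simp add: v_def lp_def)
      show "norm (v n) \<le> K * (norm (y n) + norm (0::complex))" for n
        using c(3)[of n] unfolding v_def norm_mult by (simp add: mult_right_mono)
    qed
    then obtain u where u: "u \<in> lp p" "bwd_diff w u = v"
      using bwd_diff_surj[where w = w, OF p q w_periodic wq] by meson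
    then obtain x where x: "x \<in> lp p" "fwd_diff w x = u"
      using fwd_diff_surj[where w = w, OF p q wq] by meson
    have "L x = y" using c(1) by (auto simp: fun_eq_iff L[OF x(1)] x(2) u(2) v_def)
    then show "y \<in> L ` lp p" using x(1) by auto
  qed
qed

text \<open>The head of \<open>y\<close>, divided by \<open>c\<close>, is (I - w B) u with finitely
  supported \<open>u\<close>, and \<open>u\<close> is close to some (I - w S) x. The error consists
  of the tail of \<open>y\<close> and of c (I - w B) g, where \<open>g\<close> is the error in
  \<open>u\<close>.\<close>

lemma L_dense: "lp_dense p (L ` lp p)"
  unfolding lp_dense_def
proof (intro conjI ballI allI impI)
  show "L ` lp p \<subseteq> lp p" using L_bounded(1) by auto
  fix y and \<epsilon> :: real
  assume y: "y \<in> lp p" and \<epsilon>: "0 < \<epsilon>"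
  \<comment> \<open>\<open>Q\<close> collects the constants of \<open>lp_dominated\<close> and
    \<open>bwd_diff_bounded\<close>; \<open>\<eta>\<close> makes the resulting bound
    \<open>Q * \<eta>\<close> half of \<open>\<epsilon> powr p\<close>.\<close>
  define Q where "Q = (2 * (1 + K)) powr p * (1 + 2 powr p * 2)"
  have Q: "0 < Q" using K_nonneg by (simp add: Q_def add_pos_pos)
  define \<eta> where "\<eta> = \<epsilon> powr p / (2 * Q)"
  have \<eta>: "0 < \<eta>" using Q \<epsilon> by (simp add: \<eta>_def)
  obtain M where M: "(\<lambda>n. if n < M then 0 else y n) \<in> lp p"
    "lp_pow p (\<lambda>n. if n < M then 0 else y n) < \<eta>"
    using lp_truncate[OF p_pos y \<eta>] .
  let ?h = "\<lambda>n. if n < M then 0 else y n"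
  define v where "v = (\<lambda>n. if n < M then y n / c n else 0)"
  have v: "v 0 = 0" "\<And>n. M < n \<Longrightarrow> v n = 0" using y by (auto simp: v_def lp_def)
  obtain u where u: "u \<in> lp p" "\<And>n. M < n \<Longrightarrow> u n = 0" "bwd_diff w u = v"
    using bwd_diff_surj_finite_support[where w = w and y = v and M = M and p = p, OF w_periodic v]
    by meson
  obtain x where x: "x \<in> lp p" "lp_pow p (\<lambda>n. fwd_diff w x n - u n) < \<eta>"
    using fwd_diff_dense[where w = w and M = M, OF p w_le u(1,2) \<eta>] by meson
  define g where "g = (\<lambda>n. fwd_diff w x n - u n)"
  have g: "g \<in> lp p"
  proof (rule lp_dominated(1)[OF p_pos fwd_in_lp[OF x(1)] u(1), where K = 1])
    show "g 0 = 0" using fwd_in_lp[OF x(1)] u(1) by (simp add: g_def lp_def)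
    show "norm (g n) \<le> 1 * (norm (fwd_diff w x n) + norm (u n))" for n
      using norm_triangle_ineq4 by (simp add: g_def)
  qed simp
  note bg = bwd_bounded[OF g]
  have err: "y n - L x n = ?h n - c n * bwd_diff w g n" for n
  proof -
    have "bwd_diff w g n = bwd_diff w (fwd_diff w x) n - bwd_diff w u n"
      by (simp add: bwd_diff_def g_def algebra_simps)
    then have "L x n = c n * bwd_diff w g n + c n * v n"
      by (simp add: L[OF x(1)] u(3) distrib_left[symmetric])
    moreover have "c n * v n = y n - ?h n" using c(1)[of n] by (simp add: v_def)
    ultimately show ?thesis by simp
  qed
  have "lp_pow p (\<lambda>n. y n - L x n)
      \<le> (2 * (1 + K)) powr p * (lp_pow p ?h + lp_pow p (bwd_diff w g))"
  proof (rule lp_dominated(2)[OF p_pos M(1) bg(1)])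
    show "0 \<le> 1 + K" using K_nonneg by simp
    show "y 0 - L x 0 = 0" using y L_bounded(1)[OF x(1)] by (simp add: lp_def)
    fix n
    have "norm (c n * bwd_diff w g n) \<le> K * norm (bwd_diff w g n)"
      using c(2) by (simp add: norm_mult mult_right_mono)
    moreover have "0 \<le> K * norm (?h n)" using K_nonneg by (intro mult_nonneg_nonneg) auto
    ultimately show "norm (y n - L x n) \<le> (1 + K) * (norm (?h n) + norm (bwd_diff w g n))"
      unfolding err using norm_triangle_ineq4[of "?h n" "c n * bwd_diff w g n"]
        norm_ge_zero[of "bwd_diff w g n"] unfolding distrib_right distrib_left by linarith
  qed
  also have "\<dots> \<le> (2 * (1 + K)) powr p * (\<eta> + 2 powr p * (2 * \<eta>))"
  proof (intro mult_left_mono add_mono)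
    have "2 powr p * (2 * lp_pow p g) \<le> 2 powr p * (2 * \<eta>)"
      using x(2) by (intro mult_left_mono) (auto simp: g_def)
    then show "lp_pow p (bwd_diff w g) \<le> 2 powr p * (2 * \<eta>)" using bg(2) by linarith
  qed (use M(2) in auto)
  also have "\<dots> = Q * \<eta>" by (simp add: Q_def algebra_simps)
  also have "\<dots> = \<epsilon> powr p / 2" using Q by (simp add: \<eta>_def)
  also have "\<dots> < \<epsilon> powr p" using \<epsilon> by simp
  finally have "lp_pow p (\<lambda>n. y n - L x n) < \<epsilon> powr p" .
  moreover have "0 \<le> lp_pow p (\<lambda>n. y n - L x n)"
  proof (rule lp_pow_nonneg, rule lp_dominated(1)[OF p_pos y L_bounded(1)[OF x(1)], where K = 1])
    show "y 0 - L x 0 = 0" using y L_bounded(1)[OF x(1)] by (simp add: lp_def)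
    show "norm (y n - L x n) \<le> 1 * (norm (y n) + norm (L x n))" for n
      using norm_triangle_ineq4 by simp
  qed simp
  ultimately have "lp_norm p (\<lambda>n. y n - L x n) < (\<epsilon> powr p) powr (1 / p)"
    unfolding lp_norm_eq using p_pos by (intro powr_less_mono2) auto
  also have "\<dots> = \<epsilon>" using \<epsilon> p_pos by (simp add: powr_powr)
  finally show "\<exists>z\<in>L ` lp p. lp_norm p (\<lambda>n. y n - z n) < \<epsilon>" using x(1) by blast
qed

section \<open>Failure of invertibility when |w| = 1 on the parity class of \<open>a\<close>\<close>

context
  fixes a :: nat
  assumes a: "a = 1 \<or> a = 2" and wa: "norm (w a) = 1"
begin

lemma w_add_even: "w (a + 2 * k) = w a"
proof (induction k)
  case (Suc k)
  then show ?case using w_periodic[of "a + 2 * k"] by (simp add: algebra_simps)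
qed simp

text \<open>If \<open>x\<close> is a preimage of \<open>c a\<close> times the unit vector at
  \<open>a\<close>, then (I - w S) x vanishes past \<open>a\<close> and is 1 at \<open>a\<close>. As
  the truncated \<open>a - 2\<close> is 0, \<open>x a = 1\<close>, and so |x| = 1 along a, a + 2,
  ..., although \<open>x\<close> tends to 0.\<close>

lemma L_not_surj: "L ` lp p \<noteq> lp p"
proof
  assume surj: "L ` lp p = lp p"
  define y where "y = (\<lambda>n. if n \<in> {a} then c a else 0)"
  have "summable (\<lambda>n. norm (y n) powr p)"
    by (rule summable_finite[of "{a}"]) (simp_all add: y_def)
  then have "y \<in> lp p" using a by (auto simp: lp_def y_def)
  then obtain x where x: "x \<in> lp p" "L x = y" using surj by (metis imageE)
  have x0: "x 0 = 0" using x by (simp add: lp_def)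
  have ba: "bwd_diff w (fwd_diff w x) n = (if n = a then 1 else 0)" for n
    using fun_cong[OF x(2), of n] c(1)[of n] by (auto simp: L[OF x(1)] y_def split: if_splits)
  have u0: "fwd_diff w x n = 0" if "a < n" for n
  proof (rule bwd_diff_cancel[where w = w, OF p_pos w_le fwd_in_lp[OF x(1)] lp_zero(1)])
    show "bwd_diff w (fwd_diff w x) k = bwd_diff w (\<lambda>_. 0) k" if "Suc a \<le> k" for k
      using that by (simp add: ba) (simp add: bwd_diff_def)
  qed (use that in auto)
  have "fwd_diff w x a = 1" using ba[of a] u0[of "a + 2"] a by (auto simp: bwd_diff_def)
  then have xa: "x a = 1" using a x0 by (auto simp: fwd_diff_def)
  have "norm (x (a + 2 * k)) = 1" for k
  proof (induction k)
    case (Suc k)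
    then show ?case
      using u0[of "a + 2 * Suc k"] w_add_even[of "Suc k"] wa by (simp add: fwd_diff_def norm_mult)
  qed (simp add: xa)
  moreover have "strict_mono (\<lambda>k. a + 2 * k)" by (simp add: strict_mono_def)
  then have "(\<lambda>k. norm (x (a + 2 * k))) \<longlonglongrightarrow> 0"
    using LIMSEQ_subseq_LIMSEQ[OF lp_tendsto_0[OF x(1) p_pos]]
    by (auto simp: o_def intro: tendsto_norm_zero)
  ultimately show False by (simp add: LIMSEQ_const_iff)
qed

text \<open>The geometric sequence along a, a + 2, ..., cut off after \<open>N\<close> terms, has
  p-th power norm N, while I - w S cancels it everywhere except at the two ends.\<close>

lemma approximate_eigenvector:
  "\<exists>x\<in>lp p. real N \<le> lp_pow p x \<and> lp_pow p (fwd_diff w x) \<le> 2"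
proof (intro bexI conjI)
  define S where "S = (\<lambda>k. a + 2 * k) ` {..<N}"
  \<comment> \<open>For n = a + 2 k the exponent \<open>n div 2\<close> is k or k + 1, according to
    whether a is 1 or 2; the extra factor has modulus 1.\<close>
  define x where "x = (\<lambda>n. if n \<in> S then w a ^ (n div 2) else 0)"
  have x0: "x 0 = 0" using a by (auto simp: x_def S_def)
  have S: "finite S" "card S = N" by (auto simp: S_def card_image inj_on_def)
  have xp: "norm (x n) powr p = (if n \<in> S then 1 else 0)" for n
    by (simp add: x_def norm_power wa)
  have sums: "(\<lambda>n. norm (x n) powr p) sums real N"
    unfolding xp using sums_If_finite_set[OF S(1), of "\<lambda>_. 1 :: real"] S(2) by simp
  show "x \<in> lp p" using sums x0 by (auto simp: lp_def sums_iff)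
  show "real N \<le> lp_pow p x" using sums by (simp add: lp_pow_def sums_iff)
  let ?E = "{a, a + 2 * N}"
  have E: "norm (fwd_diff w x n) powr p \<le> (if n \<in> ?E then 1 else 0)" for n
  proof -
    have mem: "n \<in> S \<longleftrightarrow> a \<le> n \<and> even (n - a) \<and> n < a + 2 * N" for n
    proof
      assume "a \<le> n \<and> even (n - a) \<and> n < a + 2 * N"
      then obtain k where "n - a = 2 * k" "a \<le> n" "n < a + 2 * N" by (elim conjE evenE)
      then have "n = a + 2 * k" "k < N" by auto
      then show "n \<in> S" by (auto simp: S_def)
    qed (auto simp: S_def)
    consider "n < a \<or> odd (n - a)" | "n = a" | "a + 2 \<le> n" "even (n - a)"
      by (cases "n = a + 1") (auto, linarith)
    then show ?thesis
    proof cases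
      case 1
      then have "x n = 0" "x (n - 2) = 0" using a by (auto simp: x_def mem)
      then show ?thesis by (simp add: fwd_diff_def)
    next
      case 2
      then have "x (n - 2) = 0" using a x0 by auto
      moreover have "norm (x n) \<le> 1" by (simp add: x_def norm_power wa)
      ultimately show ?thesis using 2 p_pos powr_mono2[of p "norm (x n)" 1]
        by (simp add: fwd_diff_def)
    next
      case 3
      then obtain k where "n - a = 2 * k" by (elim evenE)
      then have k: "n = a + 2 * k" "k \<noteq> 0" using 3 by auto
      then obtain j where j: "k = Suc j" by (cases k) auto
      have wn: "w n = w a" using w_add_even k by simp
      have d: "n div 2 = Suc ((n - 2) div 2)" using 3(1) by presburger
      \<comment> \<open>The two memberships differ only at k = N, just after the last term, where
        one entry of modulus 1 survives.\<close>
      have m: "n \<in> S \<longleftrightarrow> k < N" "n - 2 \<in> S \<longleftrightarrow> k \<le> N" using k j by (auto simp: mem)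
      have "norm (fwd_diff w x n) = (if k = N then 1 else 0)"
        using m wa d by (auto simp: fwd_diff_def x_def wn norm_mult norm_power)
      then show ?thesis using k by auto
    qed
  qed
  have sE: "(\<lambda>n. if n \<in> ?E then 1 else 0 :: real) sums (\<Sum>n\<in>?E. 1)"
    by (rule sums_If_finite_set) simp
  have "summable (\<lambda>n. norm (fwd_diff w x n) powr p)"
    using fwd_in_lp[OF \<open>x \<in> lp p\<close>] by (simp add: lp_def)
  then have "lp_pow p (fwd_diff w x) \<le> (\<Sum>n\<in>?E. 1)"
    unfolding lp_pow_def sums_unique[OF sE] by (rule suminf_le[OF E _ sums_summable[OF sE]])
  \<comment> \<open>An inequality, as the two end points coincide for N = 0.\<close>
  also have "\<dots> \<le> 2" by (simp add: card_insert_if)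
  finally show "lp_pow p (fwd_diff w x) \<le> 2" .
qed

text \<open>A bound C for the inverse would give |x| \<le> C |L x| in the p-norm. On the truncated
  geometric sequences |L x| stays bounded while |x| grows with N.\<close>

lemma L_inverse_unbounded: "\<not> lp_bounded_on p (L ` lp p) (inv_into (lp p) L)"
proof
  assume "lp_bounded_on p (L ` lp p) (inv_into (lp p) L)"
  then obtain C where "\<And>y. y \<in> L ` lp p \<Longrightarrow> lp_norm p (inv_into (lp p) L y) \<le> C * lp_norm p y"
    by (auto simp: lp_bounded_on_def)
  then have C: "lp_norm p x \<le> C * lp_norm p (L x)" if "x \<in> lp p" for x
    using that inv_into_f_f[OF L_inj] by fastforce
  define D where "D = (2 * K) powr p * (2 powr p * (2 * 2))"
  define E where "E = \<bar>C\<bar> * D powr (1 / p)"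
  have bound: "real N \<le> E powr p" for N
  proof -
    obtain x where x: "x \<in> lp p" "real N \<le> lp_pow p x" "lp_pow p (fwd_diff w x) \<le> 2"
      using approximate_eigenvector by blast
    have "(2 * K) powr p * (2 powr p * (2 * lp_pow p (fwd_diff w x))) \<le> D"
      unfolding D_def using x(3) by (intro mult_left_mono) auto
    then have "lp_pow p (L x) \<le> D" using L_bounded(2)[OF x(1)] by linarith
    then have "lp_norm p (L x) \<le> D powr (1 / p)"
      unfolding lp_norm_eq using p_pos lp_pow_nonneg[OF L_bounded(1)[OF x(1)]]
      by (intro powr_mono2) auto
    then have "\<bar>C\<bar> * lp_norm p (L x) \<le> E" by (simp add: E_def mult_left_mono)
    moreover have "C * lp_norm p (L x) \<le> \<bar>C\<bar> * lp_norm p (L x)"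
      by (intro mult_right_mono) (auto simp: lp_norm_eq)
    ultimately have "lp_norm p x \<le> E" using C[OF x(1)] by linarith
    then have "lp_norm p x powr p \<le> E powr p"
      using p_pos by (intro powr_mono2) (auto simp: lp_norm_eq)
    moreover have "lp_norm p x powr p = lp_pow p x"
      using lp_pow_nonneg[OF x(1)] p_pos by (simp add: lp_norm_eq powr_powr)
    ultimately show ?thesis using x(2) by linarith
  qed
  obtain N where "E powr p < real N" using reals_Archimedean2 by blast
  with bound[of N] show False by simp
qed

end

end

section \<open>Roots of w + 1 / w = \<mu> and the intervals\<close>

text \<open>The roots of w^2 - \<mu> w + 1 have product 1, so one of them lies in the closed unit
  disc.\<close>

lemma exists_root_norm_le_1:
  fixes \<mu> :: complex
  obtains w where "w \<noteq> 0" and "norm w \<le> 1" and "w + 1 / w = \<mu>"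
proof -
  define s where "s = csqrt (\<mu>\<^sup>2 - 4)"
  define a b where "a = (\<mu> + s) / 2" and "b = (\<mu> - s) / 2"
  have "s\<^sup>2 = \<mu>\<^sup>2 - 4" by (simp add: s_def)
  then have ab: "a * b = 1" by (simp add: a_def b_def field_simps power2_eq_square)
  have sum: "a + b = \<mu>" by (simp add: a_def b_def field_simps)
  have nz: "a \<noteq> 0" "b \<noteq> 0" using ab by auto
  have "norm a * norm b = 1" using ab by (metis norm_mult norm_one)
  then have "norm a \<le> 1 \<or> norm b \<le> 1"
    using mult_strict_mono[of 1 "norm a" 1 "norm b"] by fastforce
  moreover have "1 / a = b" "1 / b = a" using ab nz by (auto simp: field_simps)
  ultimately show thesis
    using that[of a] that[of b] nz sum by (auto simp: add.commute)
qed

text \<open>On the unit circle 1 / w is the conjugate of w, so the sum is 2 Re w. Conversely w^2 - m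
  w + 1 = 0 with real m: off the real axis m = 2 Re w, whence |w| = 1, while a real w with |m| \<le>
  2 can only be 1 or -1.\<close>

lemma norm_root_eq_1_iff:
  fixes w :: complex
  assumes w0: "w \<noteq> 0"
  shows "norm w = 1 \<longleftrightarrow> w + 1 / w \<in> complex_of_real ` {-2..2}"
proof
  assume w: "norm w = 1"
  then have "w * cnj w = 1" using complex_norm_square[of w] by simp
  then have "1 / w = cnj w" using w0 by (simp add: field_simps)
  then have "w + 1 / w = complex_of_real (2 * Re w)" by (simp add: complex_add_cnj)
  moreover have "2 * Re w \<in> {-2..2}" using abs_Re_le_cmod[of w] w by (simp add: abs_le_iff)
  ultimately show "w + 1 / w \<in> complex_of_real ` {-2..2}" by blast
next
  assume "w + 1 / w \<in> complex_of_real ` {-2..2}"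
  then obtain m where m: "\<bar>m\<bar> \<le> 2" "w + 1 / w = complex_of_real m" by (auto simp: abs_le_iff)
  then have "w * w + 1 = complex_of_real m * w" using w0 by (simp add: field_simps)
  then have re: "Re w * Re w - Im w * Im w + 1 = m * Re w" and im: "2 * Re w * Im w = m * Im w"
    by (auto simp: complex_eq_iff)
  have "(Re w)\<^sup>2 + (Im w)\<^sup>2 = 1"
  proof (cases "Im w = 0")
    case True
    have "m * Re w \<le> 2 * \<bar>Re w\<bar>"
      using m(1) abs_ge_self[of "m * Re w"] mult_right_mono[of "\<bar>m\<bar>" 2 "\<bar>Re w\<bar>"]
      by (simp add: abs_mult)
    then have "(\<bar>Re w\<bar> - 1)\<^sup>2 \<le> 0"
      using re True by (simp add: power2_eq_square algebra_simps abs_mult_self_eq)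
    then have "\<bar>Re w\<bar> = 1" by simp
    then show ?thesis using True by (simp add: abs_square_eq_1)
  next
    case False
    then have "m = 2 * Re w" using im by simp
    then show ?thesis using re by (simp add: power2_eq_square algebra_simps)
  qed
  then show "norm w = 1" by (simp add: cmod_def)
qed

lemma mem_interval_iff:
  fixes r s :: real
  assumes s: "0 < s"
  shows "z \<in> complex_of_real ` {r - 2 * s..r + 2 * s} \<longleftrightarrow>
    (z - of_real r) / of_real s \<in> complex_of_real ` {-2..2}"
proof
  assume "z \<in> complex_of_real ` {r - 2 * s..r + 2 * s}"
  then obtain t where t: "t \<in> {r - 2 * s..r + 2 * s}" "z = of_real t" by blast
  have "(z - of_real r) / of_real s = complex_of_real ((t - r) / s)" by (simp add: t(2))
  moreover have "(t - r) / s \<in> {-2..2}" using t(1) s by (auto simp: field_simps)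
  ultimately show "(z - of_real r) / of_real s \<in> complex_of_real ` {-2..2}" by blast
next
  assume "(z - of_real r) / of_real s \<in> complex_of_real ` {-2..2}"
  then obtain t where t: "t \<in> {-2..2}" "(z - of_real r) / of_real s = complex_of_real t" by blast
  have "z = complex_of_real (r + s * t)" using t(2) s by (simp add: field_simps)
  moreover have "r + s * t \<in> {r - 2 * s..r + 2 * s}"
    using t(1) s mult_left_mono[of t 2 s] mult_left_mono[of "-2" t s] by auto
  ultimately show "z \<in> complex_of_real ` {r - 2 * s..r + 2 * s}" by blast
qed

section \<open>The continuous spectrum of T0 from its factorization\<close>

theorem corollary3p7:
  fixes p r\<^sub>1 r\<^sub>2 s\<^sub>1 s\<^sub>2 :: real
  assumes "1 < p"
    and "r\<^sub>1 \<ge> 0" and "r\<^sub>2 \<ge> 0"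
    and "s\<^sub>1 > 0" and "s\<^sub>2 > 0"
  shows "cont_spectrum (T0 r\<^sub>1 r\<^sub>2 s\<^sub>1 s\<^sub>2) p =
      complex_of_real ` {r\<^sub>1 - 2 * s\<^sub>1..r\<^sub>1 + 2 * s\<^sub>1} \<union>
      complex_of_real ` {r\<^sub>2 - 2 * s\<^sub>2..r\<^sub>2 + 2 * s\<^sub>2}"
proof (rule set_eqI)
  fix z
  let ?L = "shifted_op (T0 r\<^sub>1 r\<^sub>2 s\<^sub>1 s\<^sub>2) z"
  obtain w1 where w1: "w1 \<noteq> 0" "norm w1 \<le> 1" "w1 + 1 / w1 = (z - of_real r\<^sub>1) / of_real s\<^sub>1"
    by (rule exists_root_norm_le_1)
  obtain w2 where w2: "w2 \<noteq> 0" "norm w2 \<le> 1" "w2 + 1 / w2 = (z - of_real r\<^sub>2) / of_real s\<^sub>2"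
    by (rule exists_root_norm_le_1)
  have z1: "z = of_real r\<^sub>1 + of_real s\<^sub>1 * (w1 + 1 / w1)" using w1(3) assms(4) by simp
  have z2: "z = of_real r\<^sub>2 + of_real s\<^sub>2 * (w2 + 1 / w2)" using w2(3) assms(5) by simp
  define c1 c2 where "c1 = - of_real s\<^sub>1 / w1" and "c2 = - of_real s\<^sub>2 / w2"
  define w where "w = (\<lambda>n::nat. if odd n then w1 else w2)"
  define c where "c = (\<lambda>n::nat. if odd n then c1 else c2)"
  define K where "K = norm c1 + norm c2 + norm (inverse c1) + norm (inverse c2)"
  interpret shift_factorization p K w c ?L
  proof
    show "c n \<noteq> 0" for n using w1(1) w2(1) assms by (simp add: c_def c1_def c2_def)
    show "norm (c n) \<le> K" "norm (inverse (c n)) \<le> K" for n by (auto simp: c_def K_def)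
    show wp: "w (n + 2) = w n" for n by (simp add: w_def)
    show "norm (w n) \<le> 1" for n using w1(2) w2(2) by (simp add: w_def)
    fix x n
    assume "x \<in> lp p"
    \<comment> \<open>At index 0 \<open>shifted_op\<close> leaves \<open>- z * x 0\<close>, so this
      settles the identity there.\<close>
    then have "x 0 = 0" by (simp add: lp_def)
    then show "?L x n = c n * bwd_diff w (fwd_diff w x) n"
    proof (cases "n = 0")
      case False
      \<comment> \<open>With z = r + s (w + 1 / w), the diagonal entry r - z is -(s / w) (1 + w^2),
        and the off-diagonal s is -(s / w) (-w).\<close>
      have "of_real s\<^sub>1 * x (n - 2) + of_real r\<^sub>1 * x n + of_real s\<^sub>1 * x (n + 2) - z * x n
          = c1 * ((1 + w1\<^sup>2) * x n - w1 * (x (n - 2) + x (n + 2)))"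
        unfolding z1 c1_def using w1(1) by (simp add: field_simps power2_eq_square)
      moreover have "of_real s\<^sub>2 * x (n - 2) + of_real r\<^sub>2 * x n + of_real s\<^sub>2 * x (n + 2) - z * x n
          = c2 * ((1 + w2\<^sup>2) * x n - w2 * (x (n - 2) + x (n + 2)))"
        unfolding z2 c2_def using w2(1) by (simp add: field_simps power2_eq_square)
      ultimately show ?thesis
        unfolding bwd_fwd_diff[of w, OF wp False] using False
        by (simp add: shifted_op_def T0_def w_def c_def)
    qed (simp add: shifted_op_def T0_def bwd_diff_def)
  qed (rule assms(1))
  have "z \<in> cont_spectrum (T0 r\<^sub>1 r\<^sub>2 s\<^sub>1 s\<^sub>2) p \<longleftrightarrow> norm w1 = 1 \<or> norm w2 = 1"
  proof
    assume "z \<in> cont_spectrum (T0 r\<^sub>1 r\<^sub>2 s\<^sub>1 s\<^sub>2) p"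
    then have "?L ` lp p \<noteq> lp p" by (simp add: cont_spectrum_def)
    \<comment> \<open>The larger of the two moduli serves as the bound q in
      \<open>L_surj\<close>.\<close>
    moreover have "0 \<le> max (norm w1) (norm w2)" "norm (w n) \<le> max (norm w1) (norm w2)" for n
      by (auto simp: w_def le_max_iff_disj)
    ultimately have "\<not> max (norm w1) (norm w2) < 1" using L_surj by blast
    then show "norm w1 = 1 \<or> norm w2 = 1" using w1(2) w2(2) by auto
  next
    assume "norm w1 = 1 \<or> norm w2 = 1"
    \<comment> \<open>As \<open>w 1 = w1\<close> and \<open>w 2 = w2\<close>, the index
      \<open>a\<close> selects a parity whose root has modulus 1.\<close>
    then obtain a where "a = 1 \<or> a = 2" "norm (w a) = 1"
      using that[of 1] that[of 2] by (auto simp: w_def)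
    then show "z \<in> cont_spectrum (T0 r\<^sub>1 r\<^sub>2 s\<^sub>1 s\<^sub>2) p"
      unfolding cont_spectrum_def
      using L_inj L_dense L_not_surj[of a] L_inverse_unbounded[of a] by simp
  qed
  also have "\<dots> \<longleftrightarrow> z \<in> complex_of_real ` {r\<^sub>1 - 2 * s\<^sub>1..r\<^sub>1 + 2 * s\<^sub>1} \<union>
      complex_of_real ` {r\<^sub>2 - 2 * s\<^sub>2..r\<^sub>2 + 2 * s\<^sub>2}"
    unfolding norm_root_eq_1_iff[OF w1(1)] norm_root_eq_1_iff[OF w2(1)] w1(3) w2(3) Un_iff
      mem_interval_iff[OF assms(4)] mem_interval_iff[OF assms(5)] ..
  finally show "z \<in> cont_spectrum (T0 r\<^sub>1 r\<^sub>2 s\<^sub>1 s\<^sub>2) p \<longleftrightarrow>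
      z \<in> complex_of_real ` {r\<^sub>1 - 2 * s\<^sub>1..r\<^sub>1 + 2 * s\<^sub>1} \<union>
        complex_of_real ` {r\<^sub>2 - 2 * s\<^sub>2..r\<^sub>2 + 2 * s\<^sub>2}" .
qed

end
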